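(* Let $\mathscr G$ be an ample groupoid, $R$ a unital ring, $H$ a discrete group with identity $e$, and $c\colon\mathscr G\to H$ a continuous cocycle. Then $R\mathscr G$ is graded regular (with respect to the $H$-grading induced by $c$) if and only if $R\mathscr G_e$ is von Neumann regular, where $\mathscr G_e=c^{-1}(e)$.
   Context: A ring $A$ (not necessarily unital) is von Neumann regular if for every $a\in A$ there is $b\in A$ with $aba=a$. An $H$-graded ring $\Lambda=\bigoplus_{h\in H}\Lambda_h$ is graded (von Neumann) regular if for every homogeneous $x\in\Lambda$ there is $y\in\Lambda$ with $xyx=x$. Compact means quasi-compact and Hausdorff. A topological groupoid is a nonempty groupoid $\mathscr G$ with a locally compact topology (every point has a compact Hausdorff neighborhood) such that composition and inversion are continuous; $\mathscr G$ need not be Hausdorff, but the unit space $\mathscr G^{(0)}$ is assumed Hausdorff. With source and range maps $\boldsymbol s,\boldsymbol r$, $\mathscr G$ is étale if $\boldsymbol r$ is a local homeomorphism, and ample if it is étale and $\mathscr G^{(0)}$ is locally compact Hausdorff with a basis of compact open sets. A bisection is an open set $U\subseteq\mathscr G$ such that $\boldsymbol r|_U$, $\boldsymbol s|_U$ are homeomorphisms onto open subsets of $\mathscr G^{(0)}$. $R\mathscr G$ is the left $R$-submodule of $R^{\mathscr G}$ spanned by the characteristic functions $1_U$ of compact open bisections $U$, with product $f*g(\gamma)=\sum_{\alpha\beta=\gamma}f(\alpha)g(\beta)$. A cocycle is a map $c\colon\mathscr G\to H$ with $c(\gamma\eta)=c(\gamma)c(\eta)$ for all composable $\gamma,\eta$.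 A continuous cocycle induces the $H$-grading in which the component $(R\mathscr G)_h$ is the $R$-span of the $1_U$ with $U$ a compact open bisection contained in $c^{-1}(h)$. The set $\mathscr G_e=c^{-1}(e)$ is a clopen (ample) subgroupoid and $(R\mathscr G)_e=R\mathscr G_e$. *)

theory Defs
  imports "HOL-Analysis.Analysis"
begin

text \<open>
  A groupoid is given by its arrows; objects are identified with their unit arrows. The arrow set
  is the carrier of the topology, and the operations are only meaningful on arrows
  (composition: only if \<open>src x = rng y\<close>).
\<close>

record 'g topgroupoid =
  gtop :: "'g topology"
  src :: "'g \<Rightarrow> 'g"
  rng :: "'g \<Rightarrow> 'g"
  cmp :: "'g \<Rightarrow> 'g \<Rightarrow> 'g"
  ginv :: "'g \<Rightarrow> 'g"

definition arrows :: "'g topgroupoid \<Rightarrow> 'g set" where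
  "arrows G = topspace (gtop G)"

definition units :: "'g topgroupoid \<Rightarrow> 'g set" where
  "units G = src G ` arrows G"

definition unit_space :: "'g topgroupoid \<Rightarrow> 'g topology" where
  "unit_space G = subtopology (gtop G) (units G)"

definition composable :: "'g topgroupoid \<Rightarrow> ('g \<times> 'g) set" where
  "composable G = {(x, y). x \<in> arrows G \<and> y \<in> arrows G \<and> src G x = rng G y}"

locale groupoid =
  fixes G :: "'g topgroupoid"
  assumes src_closed: "x \<in> arrows G \<Longrightarrow> src G x \<in> arrows G"
    and rng_closed: "x \<in> arrows G \<Longrightarrow> rng G x \<in> arrows G"
    and src_src: "x \<in> arrows G \<Longrightarrow> src G (src G x) = src G x"
    and rng_src: "x \<in> arrows G \<Longrightarrow> rng G (src G x) = src G x"
    and src_rng: "x \<in> arrows G \<Longrightarrow> src G (rng G x) = rng G x"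
    and rng_rng: "x \<in> arrows G \<Longrightarrow> rng G (rng G x) = rng G x"
    and cmp_closed: "(x, y) \<in> composable G \<Longrightarrow> cmp G x y \<in> arrows G"
    and src_cmp: "(x, y) \<in> composable G \<Longrightarrow> src G (cmp G x y) = src G y"
    and rng_cmp: "(x, y) \<in> composable G \<Longrightarrow> rng G (cmp G x y) = rng G x"
    and cmp_assoc: "(x, y) \<in> composable G \<Longrightarrow> (y, z) \<in> composable G \<Longrightarrow>
          cmp G (cmp G x y) z = cmp G x (cmp G y z)"
    and cmp_rng: "x \<in> arrows G \<Longrightarrow> cmp G (rng G x) x = x"
    and cmp_src: "x \<in> arrows G \<Longrightarrow> cmp G x (src G x) = x"
    and ginv_closed: "x \<in> arrows G \<Longrightarrow> ginv G x \<in> arrows G"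
    and src_ginv: "x \<in> arrows G \<Longrightarrow> src G (ginv G x) = rng G x"
    and rng_ginv: "x \<in> arrows G \<Longrightarrow> rng G (ginv G x) = src G x"
    and cmp_ginv_left: "x \<in> arrows G \<Longrightarrow> cmp G (ginv G x) x = src G x"
    and cmp_ginv_right: "x \<in> arrows G \<Longrightarrow> cmp G x (ginv G x) = rng G x"

text \<open>
  \<open>compactin\<close> is quasi-compactness, whereas ``compact'' here includes the Hausdorff property. The
  arrow space of a groupoid need not be Hausdorff, so this matters below.
\<close>

definition compact_Hausdorff_in :: "'a topology \<Rightarrow> 'a set \<Rightarrow> bool" where
  "compact_Hausdorff_in X K \<longleftrightarrow> compactin X K \<and> Hausdorff_space (subtopology X K)"

locale topological_groupoid = groupoid +
  assumes nonempty: "arrows G \<noteq> {}"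
    and locally_compact: "x \<in> arrows G \<Longrightarrow>
          \<exists>U K. openin (gtop G) U \<and> compact_Hausdorff_in (gtop G) K \<and> x \<in> U \<and> U \<subseteq> K"
    and continuous_cmp:
          "continuous_map (subtopology (prod_topology (gtop G) (gtop G)) (composable G)) (gtop G)
             (\<lambda>(x, y). cmp G x y)"
    and continuous_ginv: "continuous_map (gtop G) (gtop G) (ginv G)"
    and Hausdorff_unit_space: "Hausdorff_space (unit_space G)"

definition local_homeomorphism :: "'a topology \<Rightarrow> 'b topology \<Rightarrow> ('a \<Rightarrow> 'b) \<Rightarrow> bool" where
  "local_homeomorphism X Y f \<longleftrightarrow>
     (\<forall>x\<in>topspace X. \<exists>U. openin X U \<and> x \<in> U \<and> openin Y (f ` U) \<and>
        homeomorphic_map (subtopology X U) (subtopology Y (f ` U)) f)"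

locale etale_groupoid = topological_groupoid +
  assumes local_homeomorphism_rng: "local_homeomorphism (gtop G) (unit_space G) (rng G)"

locale ample_groupoid = etale_groupoid +
  assumes locally_compact_unit_space: "locally_compact_space (unit_space G)"
    and compact_open_basis:
          "\<exists>\<B>. (\<forall>U\<in>\<B>. openin (unit_space G) U \<and> compact_Hausdorff_in (unit_space G) U) \<and>
               openin (unit_space G) = arbitrary union_of (\<lambda>U. U \<in> \<B>)"

definition bisection :: "'g topgroupoid \<Rightarrow> 'g set \<Rightarrow> bool" where
  "bisection G U \<longleftrightarrow> openin (gtop G) U \<and>
     openin (unit_space G) (rng G ` U) \<and>
     homeomorphic_map (subtopology (gtop G) U) (subtopology (unit_space G) (rng G ` U)) (rng G) \<and>
     openin (unit_space G) (src G ` U) \<and>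
     homeomorphic_map (subtopology (gtop G) U) (subtopology (unit_space G) (src G ` U)) (src G)"

definition compact_open_bisection :: "'g topgroupoid \<Rightarrow> 'g set \<Rightarrow> bool" where
  "compact_open_bisection G U \<longleftrightarrow> bisection G U \<and> compact_Hausdorff_in (gtop G) U"

text \<open>
  Coefficient rings have sort \<open>{ring, monoid_mult}\<close> rather than \<open>ring_1\<close>, so that the
  zero ring is allowed; \<open>indicator\<close> and \<open>module.span\<close> are therefore not available (the latter
  moreover needs commutativity). Functions on the arrows are functions on the whole type that
  vanish outside the arrows.
\<close>

definition char_fun :: "'g set \<Rightarrow> 'g \<Rightarrow> 'r::{ring, monoid_mult}" where
  "char_fun U = (\<lambda>x. if x \<in> U then 1 else 0)"

definition left_span :: "('g \<Rightarrow> 'r) set \<Rightarrow> ('g \<Rightarrow> 'r::{ring, monoid_mult}) set" where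
  "left_span S = {(\<lambda>x. \<Sum>\<phi>\<in>T. a \<phi> * \<phi> x) | T a. finite T \<and> T \<subseteq> S}"

definition steinberg_algebra :: "'g topgroupoid \<Rightarrow> ('g \<Rightarrow> 'r::{ring, monoid_mult}) set" where
  "steinberg_algebra G = left_span {char_fun U | U. compact_open_bisection G U}"

text \<open>
  The sum ranges over the pairs of the supports only; for elements of the Steinberg algebra
  there are finitely many of them, since a source or range fibre meets a bisection in at most
  one point.
\<close>

definition convolution ::
  "'g topgroupoid \<Rightarrow> ('g \<Rightarrow> 'r) \<Rightarrow> ('g \<Rightarrow> 'r) \<Rightarrow> 'g \<Rightarrow> 'r::{ring, monoid_mult}" where
  "convolution G f g = (\<lambda>\<gamma>.
     \<Sum>(\<alpha>, \<beta>) \<in> {(\<alpha>, \<beta>) \<in> composable G. cmp G \<alpha> \<beta> = \<gamma> \<and> f \<alpha> \<noteq> 0 \<and> g \<beta> \<noteq> 0}. f \<alpha> * g \<beta>)"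

text \<open>
  The class \<open>group_add\<close> does not include commutativity: the grading group is an arbitrary
  group in additive notation, with identity \<open>0\<close>.
\<close>

definition cocycle :: "'g topgroupoid \<Rightarrow> ('g \<Rightarrow> 'h::group_add) \<Rightarrow> bool" where
  "cocycle G c \<longleftrightarrow> (\<forall>(x, y) \<in> composable G. c (cmp G x y) = c x + c y)"

definition continuous_cocycle :: "'g topgroupoid \<Rightarrow> ('g \<Rightarrow> 'h::group_add) \<Rightarrow> bool" where
  "continuous_cocycle G c \<longleftrightarrow>
     cocycle G c \<and> continuous_map (gtop G) (discrete_topology UNIV) c"

definition steinberg_component ::
  "'g topgroupoid \<Rightarrow> ('g \<Rightarrow> 'h::group_add) \<Rightarrow> 'h \<Rightarrow> ('g \<Rightarrow> 'r::{ring, monoid_mult}) set" where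
  "steinberg_component G c h =
     left_span {char_fun U | U. compact_open_bisection G U \<and> U \<subseteq> c -` {h}}"

definition kernel_groupoid :: "'g topgroupoid \<Rightarrow> ('g \<Rightarrow> 'h::group_add) \<Rightarrow> 'g topgroupoid" where
  "kernel_groupoid G c = G\<lparr>gtop := subtopology (gtop G) (c -` {0})\<rparr>"

text \<open>
  A possibly non-unital ring is given by its carrier and its multiplication, the only data that
  regularity refers to; a grading is given by the family of its components.
\<close>

definition von_neumann_regular :: "'a set \<Rightarrow> ('a \<Rightarrow> 'a \<Rightarrow> 'a) \<Rightarrow> bool" where
  "von_neumann_regular A m \<longleftrightarrow> (\<forall>a\<in>A. \<exists>b\<in>A. m (m a b) a = a)"

definition graded_regular :: "'a set \<Rightarrow> ('a \<Rightarrow> 'a \<Rightarrow> 'a) \<Rightarrow> ('h \<Rightarrow> 'a set) \<Rightarrow> bool" where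
  "graded_regular A m \<Lambda> \<longleftrightarrow> (\<forall>h. \<forall>x\<in>\<Lambda> h. \<exists>y\<in>A. m (m x y) x = x)"

end

theory Submission
  imports Defs "HOL-Library.Function_Algebras"
begin

text \<open>
  Let \<open>x\<close> be homogeneous of degree \<open>h\<close>, supported on compact open bisections \<open>U\<^sub>1, \<dots>, U\<^sub>n\<close> of
  degree \<open>h\<close>, and let \<open>b\<^sub>i\<close> be the indicator of \<open>U\<^sub>i\<inverse>\<close>. The elements \<open>b\<^sub>i x\<close> lie in the degree
  zero part. If that ring is regular, the left ideal they generate there is generated by an idempotent
  of the form \<open>w x\<close> with \<open>w\<close> of degree \<open>-h\<close>, so \<open>b\<^sub>i x w x = b\<^sub>i x\<close> for all \<open>i\<close>. Left
  multiplication by \<open>b\<^sub>i\<close> merely translates along \<open>U\<^sub>i\<close>, so no information on the rows meeting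
  \<open>U\<^sub>i\<close> is lost, and \<open>x w x = x\<close>. Conversely, a quasi-inverse of an element of degree zero may be
  replaced by its own part of degree zero.
\<close>

section \<open>Left spans\<close>

lemma left_spanI:
  assumes "finite T" "T \<subseteq> S" "\<And>x. f x = (\<Sum>\<phi>\<in>T. a \<phi> * \<phi> x)"
  shows "f \<in> left_span S"
  using assms unfolding left_span_def by (intro CollectI exI[of _ T] exI[of _ a]) auto

lemma left_span_scale:
  assumes "\<phi> \<in> S"
  shows "(\<lambda>x. a * \<phi> x) \<in> left_span S"
  by (rule left_spanI[of "{\<phi>}" _ _ "\<lambda>_. a"]) (use assms in auto)

lemma left_span_0: "0 \<in> left_span S"
  by (rule left_spanI[of "{}"]) auto

lemma left_span_add:
  assumes "f \<in> left_span S" "g \<in> left_span S"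
  shows "f + g \<in> left_span S"
proof -
  obtain T a where T: "finite T" "T \<subseteq> S" and f: "f = (\<lambda>x. \<Sum>\<phi>\<in>T. a \<phi> * \<phi> x)"
    using assms(1) unfolding left_span_def by blast
  obtain T' a' where T': "finite T'" "T' \<subseteq> S" and g: "g = (\<lambda>x. \<Sum>\<phi>\<in>T'. a' \<phi> * \<phi> x)"
    using assms(2) unfolding left_span_def by blast
  \<comment> \<open>Extending both coefficient families by 0 lets the two sums run over one index
    set; a generator that occurs in both receives the sum of its two coefficients.\<close>
  define b where "b \<phi> = (if \<phi> \<in> T then a \<phi> else 0) + (if \<phi> \<in> T' then a' \<phi> else 0)" for \<phi>
  have "f x + g x = (\<Sum>\<phi>\<in>T \<union> T'. b \<phi> * \<phi> x)" for x
  proof -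
    have "f x = (\<Sum>\<phi>\<in>T \<union> T'. (if \<phi> \<in> T then a \<phi> else 0) * \<phi> x)"
      unfolding f using T T' by (intro sum.mono_neutral_cong_left) auto
    moreover have "g x = (\<Sum>\<phi>\<in>T \<union> T'. (if \<phi> \<in> T' then a' \<phi> else 0) * \<phi> x)"
      unfolding g using T T' by (intro sum.mono_neutral_cong_left) auto
    ultimately show ?thesis
      by (simp add: b_def distrib_right sum.distrib)
  qed
  then show ?thesis
    using T T' by (intro left_spanI[of "T \<union> T'" _ _ b]) auto
qed

lemma left_span_uminus:
  assumes "f \<in> left_span S"
  shows "- f \<in> left_span S"
proof -
  obtain T a where T: "finite T" "T \<subseteq> S" and f: "f = (\<lambda>x. \<Sum>\<phi>\<in>T. a \<phi> * \<phi> x)"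
    using assms unfolding left_span_def by blast
  show ?thesis
    using T by (intro left_spanI[of T _ _ "\<lambda>\<phi>. - a \<phi>"]) (auto simp: f sum_negf)
qed

lemma left_span_diff:
  assumes "f \<in> left_span S" "g \<in> left_span S"
  shows "f - g \<in> left_span S"
  using left_span_add[OF assms(1) left_span_uminus[OF assms(2)]] by simp

lemma left_span_mono: "S \<subseteq> T \<Longrightarrow> left_span S \<subseteq> left_span T"
  unfolding left_span_def by blast

text \<open>A representing sum is built up one scaled generator at a time. The step does not record
  that \<open>f\<close> lies in the span, so whatever is needed about \<open>f\<close> has to be
  part of \<open>P\<close>.\<close>

lemma left_span_induct [consumes 1, case_names zero add]:
  assumes "f \<in> left_span S"
    and "P 0"
    and "\<And>f \<phi> a. P f \<Longrightarrow> \<phi> \<in> S \<Longrightarrow> P (f + (\<lambda>x. a * \<phi> x))"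
  shows "P f"
proof -
  obtain T a where T: "finite T" "T \<subseteq> S" and f: "f = (\<lambda>x. \<Sum>\<phi>\<in>T. a \<phi> * \<phi> x)"
    using assms(1) unfolding left_span_def by blast
  have "P (\<lambda>x. \<Sum>\<phi>\<in>T. a \<phi> * \<phi> x)"
    using T
  proof (induction T rule: finite_induct)
    case empty
    then show ?case
      using assms(2) by (simp add: zero_fun_def)
  next
    case (insert \<phi> T)
    have "(\<lambda>x. \<Sum>\<psi>\<in>insert \<phi> T. a \<psi> * \<psi> x) = (\<lambda>x. \<Sum>\<psi>\<in>T. a \<psi> * \<psi> x) + (\<lambda>x. a \<phi> * \<phi> x)"
      using insert.hyps by (simp add: fun_eq_iff add.commute)
    then show ?case
      using assms(3) insert by simp
  qed
  then show ?thesis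
    by (simp add: f)
qed

section \<open>Convolution of row-finite functions\<close>

context groupoid
begin

section \<open>Cancellation laws in a groupoid\<close>

lemma composable_iff: "(x, y) \<in> composable G \<longleftrightarrow> x \<in> arrows G \<and> y \<in> arrows G \<and> src G x = rng G y"
  by (auto simp: composable_def)

lemmas groupoid_simps =
  src_closed rng_closed src_src rng_src src_rng rng_rng ginv_closed src_ginv rng_ginv
  cmp_closed src_cmp rng_cmp composable_iff

lemma ginv_cmp_cancel:
  assumes "(x, y) \<in> composable G"
  shows "cmp G (ginv G x) (cmp G x y) = y"
  using assms cmp_assoc[of "ginv G x" x y] cmp_ginv_left[of x] cmp_rng[of y]
  by (auto simp: groupoid_simps)

lemma cmp_ginv_cancel:
  assumes "x \<in> arrows G" "y \<in> arrows G" "rng G x = rng G y"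
  shows "cmp G x (cmp G (ginv G x) y) = y"
  using assms cmp_assoc[of x "ginv G x" y] cmp_ginv_right[of x] cmp_rng[of y]
  by (auto simp: groupoid_simps)

lemma ginv_ginv:
  assumes "x \<in> arrows G"
  shows "ginv G (ginv G x) = x"
  using ginv_cmp_cancel[of "ginv G x" x] assms cmp_ginv_left[of x] cmp_src[of "ginv G (ginv G x)"]
  by (simp add: groupoid_simps)

lemma rng_in_units: "x \<in> arrows G \<Longrightarrow> rng G x \<in> units G"
  using src_rng rng_closed unfolding units_def by force

lemma src_in_units: "x \<in> arrows G \<Longrightarrow> src G x \<in> units G"
  unfolding units_def by blast

section \<open>Row-finite functions and biadditivity of convolution\<close>

definition row_support :: "('g \<Rightarrow> 'r::zero) \<Rightarrow> 'g \<Rightarrow> 'g set" where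
  "row_support f \<gamma> = {\<alpha> \<in> arrows G. rng G \<alpha> = rng G \<gamma> \<and> f \<alpha> \<noteq> 0}"

text \<open>A topology-free condition under which convolution with left factor \<open>f\<close> is a
  finite sum at every arrow: the left factors of \<gamma> are arrows with the range of
  \<gamma>.\<close>

definition row_finite :: "('g \<Rightarrow> 'r::zero) \<Rightarrow> bool" where
  "row_finite f \<longleftrightarrow> (\<forall>x. x \<notin> arrows G \<longrightarrow> f x = 0) \<and> (\<forall>\<gamma>\<in>arrows G. finite (row_support f \<gamma>))"

lemma row_finite_outside: "row_finite f \<Longrightarrow> x \<notin> arrows G \<Longrightarrow> f x = 0"
  by (simp add: row_finite_def)

lemma finite_row_support: "row_finite f \<Longrightarrow> \<gamma> \<in> arrows G \<Longrightarrow> finite (row_support f \<gamma>)"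
  by (simp add: row_finite_def)

lemma convolution_outside: "\<gamma> \<notin> arrows G \<Longrightarrow> convolution G f g \<gamma> = 0"
  using cmp_closed by (auto simp: convolution_def intro!: sum.neutral)

text \<open>A composable pair with product \<gamma> is determined by its left factor \<alpha>, since
  the right factor must be \<alpha>\<inverse>\<gamma>. The index set \<open>F\<close> may exceed the
  row support, so that different left factors can share one index set.\<close>

lemma convolution_eq_sum:
  assumes "\<gamma> \<in> arrows G" "finite F" "row_support f \<gamma> \<subseteq> F"
    and F: "\<And>\<alpha>. \<alpha> \<in> F \<Longrightarrow> \<alpha> \<in> arrows G \<and> rng G \<alpha> = rng G \<gamma>"
  shows "convolution G f g \<gamma> = (\<Sum>\<alpha>\<in>F. f \<alpha> * g (cmp G (ginv G \<alpha>) \<gamma>))"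
proof -
  let ?F = "{\<alpha> \<in> F. f \<alpha> \<noteq> 0 \<and> g (cmp G (ginv G \<alpha>) \<gamma>) \<noteq> 0}"
  let ?p = "\<lambda>\<alpha>. (\<alpha>, cmp G (ginv G \<alpha>) \<gamma>)"
  have *: "{(\<alpha>, \<beta>) \<in> composable G. cmp G \<alpha> \<beta> = \<gamma> \<and> f \<alpha> \<noteq> 0 \<and> g \<beta> \<noteq> 0} = ?p ` ?F"
  proof (intro equalityI subsetI)
    fix p
    assume "p \<in> {(\<alpha>, \<beta>) \<in> composable G. cmp G \<alpha> \<beta> = \<gamma> \<and> f \<alpha> \<noteq> 0 \<and> g \<beta> \<noteq> 0}"
    then obtain \<alpha> \<beta> where p: "p = (\<alpha>, \<beta>)" "(\<alpha>, \<beta>) \<in> composable G" "cmp G \<alpha> \<beta> = \<gamma>" "f \<alpha> \<noteq> 0" "g \<beta> \<noteq> 0"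
      by auto
    then have "\<alpha> \<in> F" "\<beta> = cmp G (ginv G \<alpha>) \<gamma>"
      using assms(3) ginv_cmp_cancel rng_cmp by (auto simp: row_support_def composable_iff)
    then show "p \<in> ?p ` ?F"
      using p by auto
  next
    fix p
    assume "p \<in> ?p ` ?F"
    then obtain \<alpha> where \<alpha>: "p = ?p \<alpha>" "\<alpha> \<in> ?F"
      by blast
    with F assms(1) show "p \<in> {(\<alpha>, \<beta>) \<in> composable G. cmp G \<alpha> \<beta> = \<gamma> \<and> f \<alpha> \<noteq> 0 \<and> g \<beta> \<noteq> 0}"
      by (auto simp: groupoid_simps cmp_ginv_cancel)
  qed
  have "convolution G f g \<gamma> = (\<Sum>\<alpha>\<in>?F. f \<alpha> * g (cmp G (ginv G \<alpha>) \<gamma>))"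
    unfolding convolution_def * by (subst sum.reindex) (auto simp: inj_on_def)
  also have "\<dots> = (\<Sum>\<alpha>\<in>F. f \<alpha> * g (cmp G (ginv G \<alpha>) \<gamma>))"
    using assms(2) by (intro sum.mono_neutral_left) auto
  finally show ?thesis .
qed

lemma convolution_row_support:
  assumes "row_finite f" "\<gamma> \<in> arrows G"
  shows "convolution G f g \<gamma> = (\<Sum>\<alpha>\<in>row_support f \<gamma>. f \<alpha> * g (cmp G (ginv G \<alpha>) \<gamma>))"
  using assms by (intro convolution_eq_sum) (auto simp: row_support_def row_finite_def)

lemma row_finite_0: "row_finite 0"
  by (simp add: row_finite_def row_support_def)

lemma row_finite_add:
  fixes f g :: "'g \<Rightarrow> 'r::monoid_add"
  assumes "row_finite f" "row_finite g"
  shows "row_finite (f + g)"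
proof -
  have "row_support (f + g) \<gamma> \<subseteq> row_support f \<gamma> \<union> row_support g \<gamma>" for \<gamma>
    by (auto simp: row_support_def)
  then show ?thesis
    using assms by (simp add: row_finite_def) (meson finite_subset finite_UnI)
qed

lemma convolution_add_left:
  fixes f g h :: "'g \<Rightarrow> 'r::{ring, monoid_mult}"
  assumes "row_finite f" "row_finite g"
  shows "convolution G (f + g) h = convolution G f h + convolution G g h"
proof
  fix \<gamma>
  show "convolution G (f + g) h \<gamma> = (convolution G f h + convolution G g h) \<gamma>"
  proof (cases "\<gamma> \<in> arrows G")
    case True
    define F where "F = row_support f \<gamma> \<union> row_support g \<gamma>"
    have F: "finite F" "\<And>\<alpha>. \<alpha> \<in> F \<Longrightarrow> \<alpha> \<in> arrows G \<and> rng G \<alpha> = rng G \<gamma>"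
      using True assms by (auto simp: F_def row_finite_def row_support_def)
    have sub: "row_support f \<gamma> \<subseteq> F" "row_support g \<gamma> \<subseteq> F" "row_support (f + g) \<gamma> \<subseteq> F"
      by (auto simp: F_def row_support_def)
    show ?thesis
      by (simp add: convolution_eq_sum[OF True F(1) _ F(2)] sub distrib_right sum.distrib)
  qed (simp add: convolution_outside)
qed

lemma convolution_add_right:
  fixes f g h :: "'g \<Rightarrow> 'r::{ring, monoid_mult}"
  assumes "row_finite f"
  shows "convolution G f (g + h) = convolution G f g + convolution G f h"
proof
  fix \<gamma>
  show "convolution G f (g + h) \<gamma> = (convolution G f g + convolution G f h) \<gamma>"
    using assms
    by (cases "\<gamma> \<in> arrows G")
      (simp_all add: convolution_row_support convolution_outside distrib_left sum.distrib)
qed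

lemma convolution_0_left: "convolution G 0 g = 0"
  by (simp add: convolution_def fun_eq_iff)

lemma convolution_0_right: "convolution G f 0 = 0"
  by (simp add: convolution_def fun_eq_iff)

lemma row_finite_diff:
  fixes f g :: "'g \<Rightarrow> 'r::group_add"
  assumes "row_finite f" "row_finite g"
  shows "row_finite (f - g)"
proof -
  have "row_support (f - g) \<gamma> \<subseteq> row_support f \<gamma> \<union> row_support g \<gamma>" for \<gamma>
    by (auto simp: row_support_def)
  then show ?thesis
    using assms by (simp add: row_finite_def) (meson finite_subset finite_UnI)
qed

lemma convolution_diff_left:
  fixes f g h :: "'g \<Rightarrow> 'r::{ring, monoid_mult}"
  assumes "row_finite f" "row_finite g"
  shows "convolution G (f - g) h = convolution G f h - convolution G g h"
  using convolution_add_left[of "f - g" g h] assms row_finite_diff[of f g] by (simp add: algebra_simps)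

lemma convolution_diff_right:
  fixes f g h :: "'g \<Rightarrow> 'r::{ring, monoid_mult}"
  assumes "row_finite f"
  shows "convolution G f (g - h) = convolution G f g - convolution G f h"
  using convolution_add_right[of f "g - h" h] assms by (simp add: algebra_simps)

text \<open>A nonzero value at \<beta> forces a nonzero term, that is, a factorization of \<beta>
  into an arrow where \<open>f\<close> is nonzero and one where \<open>g\<close> is. The bound is
  kept as an explicit set because associativity sums over it.\<close>

lemma row_support_convolution:
  fixes f g :: "'g \<Rightarrow> 'r::{ring, monoid_mult}"
  assumes "row_finite f" "\<gamma> \<in> arrows G"
  shows "row_support (convolution G f g) \<gamma> \<subseteq>
           (\<Union>\<alpha>\<in>row_support f \<gamma>. cmp G \<alpha> ` row_support g (src G \<alpha>))"
proof
  fix \<beta>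
  assume "\<beta> \<in> row_support (convolution G f g) \<gamma>"
  then have \<beta>: "\<beta> \<in> arrows G" "rng G \<beta> = rng G \<gamma>" "convolution G f g \<beta> \<noteq> 0"
    by (auto simp: row_support_def)
  then obtain \<alpha> where \<alpha>: "\<alpha> \<in> row_support f \<beta>" "f \<alpha> * g (cmp G (ginv G \<alpha>) \<beta>) \<noteq> 0"
    using assms(1) by (auto simp: convolution_row_support elim!: sum.not_neutral_contains_not_neutral)
  from \<alpha>(2) have "g (cmp G (ginv G \<alpha>) \<beta>) \<noteq> 0"
    by auto
  then have "\<alpha> \<in> row_support f \<gamma>" "cmp G (ginv G \<alpha>) \<beta> \<in> row_support g (src G \<alpha>)"
    "\<beta> = cmp G \<alpha> (cmp G (ginv G \<alpha>) \<beta>)"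
    using \<alpha>(1) \<beta> by (auto simp: row_support_def groupoid_simps cmp_ginv_cancel)
  then show "\<beta> \<in> (\<Union>\<alpha>\<in>row_support f \<gamma>. cmp G \<alpha> ` row_support g (src G \<alpha>))"
    by blast
qed

lemma finite_row_support_product:
  assumes "row_finite f" "row_finite g" "\<gamma> \<in> arrows G"
  shows "finite (\<Union>\<alpha>\<in>row_support f \<gamma>. cmp G \<alpha> ` row_support g (src G \<alpha>))"
proof (intro finite_UN_I finite_imageI)
  fix \<alpha>
  assume "\<alpha> \<in> row_support f \<gamma>"
  then show "finite (row_support g (src G \<alpha>))"
    using assms(2) src_closed by (intro finite_row_support) (auto simp: row_support_def)
qed (rule finite_row_support[OF assms(1,3)])

lemma row_finite_convolution:
  fixes f g :: "'g \<Rightarrow> 'r::{ring, monoid_mult}"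
  assumes "row_finite f" "row_finite g"
  shows "row_finite (convolution G f g)"
  unfolding row_finite_def
  using convolution_outside finite_subset[OF row_support_convolution finite_row_support_product] assms
  by blast

text \<open>The left side is summed over all products \<open>F\<close> of arrows from the two
  supports. Exchanging the sums leaves, for each \<alpha>, a sum over \<beta> that the substitution
  of \<alpha>\<inverse>\<beta> for \<beta> identifies with a value of
  \<open>convolution G g h\<close>.\<close>

lemma convolution_assoc:
  fixes f g h :: "'g \<Rightarrow> 'r::{ring, monoid_mult}"
  assumes f: "row_finite f" and g: "row_finite g"
  shows "convolution G (convolution G f g) h = convolution G f (convolution G g h)"
proof
  fix \<gamma>
  show "convolution G (convolution G f g) h \<gamma> = convolution G f (convolution G g h) \<gamma>"
  proof (cases "\<gamma> \<in> arrows G")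
    case \<gamma>: True
    define F where "F = (\<Union>\<alpha>\<in>row_support f \<gamma>. cmp G \<alpha> ` row_support g (src G \<alpha>))"
    have F: "\<beta> \<in> arrows G \<and> rng G \<beta> = rng G \<gamma>" if "\<beta> \<in> F" for \<beta>
      using that \<gamma> by (auto simp: F_def row_support_def groupoid_simps)
    have fin: "finite F"
      unfolding F_def by (rule finite_row_support_product[OF f g \<gamma>])
    have inner: "(\<Sum>\<beta>\<in>F. g (cmp G (ginv G \<alpha>) \<beta>) * h (cmp G (ginv G \<beta>) \<gamma>)) =
        convolution G g h (cmp G (ginv G \<alpha>) \<gamma>)" if \<alpha>: "\<alpha> \<in> row_support f \<gamma>" for \<alpha>
    proof -
      let ?t = "\<lambda>\<beta>. cmp G (ginv G \<alpha>) \<beta>"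
      have \<alpha>': "\<alpha> \<in> arrows G" "rng G \<alpha> = rng G \<gamma>"
        using \<alpha> by (auto simp: row_support_def)
      have inj: "inj_on ?t F"
        by (rule inj_on_inverseI[where g = "cmp G \<alpha>"]) (use F \<alpha>' cmp_ginv_cancel in auto)
      \<comment> \<open>\<open>F\<close> is large enough for the substitution: each \<delta> in this
        row is the translate by \<alpha>\<inverse> of the element \<alpha>\<delta> of
        \<open>F\<close>.\<close>
      have sub: "row_support g (?t \<gamma>) \<subseteq> ?t ` F"
      proof
        fix \<delta>
        assume "\<delta> \<in> row_support g (?t \<gamma>)"
        then have "\<delta> \<in> row_support g (src G \<alpha>)" "(\<alpha>, \<delta>) \<in> composable G"
          using \<alpha>' \<gamma> by (auto simp: row_support_def groupoid_simps)
        then have "cmp G \<alpha> \<delta> \<in> F" "\<delta> = ?t (cmp G \<alpha> \<delta>)"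
          using \<alpha> ginv_cmp_cancel by (auto simp: F_def)
        then show "\<delta> \<in> ?t ` F"
          by blast
      qed
      have "convolution G g h (?t \<gamma>) = (\<Sum>\<delta>\<in>?t ` F. g \<delta> * h (cmp G (ginv G \<delta>) (?t \<gamma>)))"
        using sub fin F \<alpha>' \<gamma> by (intro convolution_eq_sum) (auto simp: groupoid_simps)
      also have "\<dots> = (\<Sum>\<beta>\<in>F. g (?t \<beta>) * h (cmp G (ginv G (?t \<beta>)) (?t \<gamma>)))"
        by (simp add: sum.reindex[OF inj])
      also have "\<dots> = (\<Sum>\<beta>\<in>F. g (?t \<beta>) * h (cmp G (ginv G \<beta>) \<gamma>))"
      proof (intro sum.cong refl)
        fix \<beta>
        assume "\<beta> \<in> F"
        then have \<beta>: "\<beta> \<in> arrows G" "rng G \<beta> = rng G \<gamma>"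
          using F by auto
        \<comment> \<open>From (\<alpha>\<inverse>\<beta>)(\<beta>\<inverse>\<gamma>) =
          \<alpha>\<inverse>\<gamma>, cancelling the first factor shows that the argument of
          \<open>h\<close> does not depend on \<alpha>.\<close>
        have "cmp G (?t \<beta>) (cmp G (ginv G \<beta>) \<gamma>) = ?t \<gamma>"
          using \<beta> \<alpha>' \<gamma> cmp_assoc[of "ginv G \<alpha>" \<beta> "cmp G (ginv G \<beta>) \<gamma>"]
          by (simp add: groupoid_simps cmp_ginv_cancel)
        then have "cmp G (ginv G (?t \<beta>)) (?t \<gamma>) = cmp G (ginv G \<beta>) \<gamma>"
          using \<beta> \<alpha>' \<gamma> ginv_cmp_cancel[of "?t \<beta>" "cmp G (ginv G \<beta>) \<gamma>"]
          by (simp add: groupoid_simps)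
        then show "g (?t \<beta>) * h (cmp G (ginv G (?t \<beta>)) (?t \<gamma>)) = g (?t \<beta>) * h (cmp G (ginv G \<beta>) \<gamma>)"
          by simp
      qed
      finally show ?thesis ..
    qed
    have "convolution G (convolution G f g) h \<gamma> =
        (\<Sum>\<beta>\<in>F. convolution G f g \<beta> * h (cmp G (ginv G \<beta>) \<gamma>))"
      using row_support_convolution[OF f \<gamma>] F fin \<gamma> by (intro convolution_eq_sum) (auto simp: F_def)
    also have "\<dots> = (\<Sum>\<beta>\<in>F. \<Sum>\<alpha>\<in>row_support f \<gamma>.
        f \<alpha> * g (cmp G (ginv G \<alpha>) \<beta>) * h (cmp G (ginv G \<beta>) \<gamma>))"
      using F f by (intro sum.cong)
        (simp_all add: convolution_row_support sum_distrib_right row_support_def)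
    also have "\<dots> = (\<Sum>\<alpha>\<in>row_support f \<gamma>. f \<alpha> * convolution G g h (cmp G (ginv G \<alpha>) \<gamma>))"
      by (subst sum.swap) (simp add: inner[symmetric] sum_distrib_left mult.assoc)
    finally show ?thesis
      using f \<gamma> by (simp add: convolution_row_support)
  qed (simp add: convolution_outside)
qed

section \<open>Convolution of characteristic functions\<close>

definition arrow_product :: "'g set \<Rightarrow> 'g set \<Rightarrow> 'g set" where
  "arrow_product U V = {cmp G x y | x y. (x, y) \<in> composable G \<and> x \<in> U \<and> y \<in> V}"

text \<open>Injectivity of the range on \<open>U\<close> leaves at most one arrow of
  \<open>U\<close> in each row.\<close>

lemma row_finite_char_fun:
  fixes a :: "'r::{ring, monoid_mult}"
  assumes "U \<subseteq> arrows G" "inj_on (rng G) U"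
  shows "row_finite (\<lambda>x. a * char_fun U x)"
proof -
  have "finite (row_support (\<lambda>x. a * char_fun U x) \<gamma>)" for \<gamma>
  proof (rule inj_on_finite[of "rng G" _ "{rng G \<gamma>}"])
    show "inj_on (rng G) (row_support (\<lambda>x. a * char_fun U x) \<gamma>)"
      by (rule inj_on_subset[OF assms(2)]) (auto simp: row_support_def char_fun_def split: if_splits)
  qed (auto simp: row_support_def)
  then show ?thesis
    using assms(1) by (auto simp: row_finite_def char_fun_def)
qed

text \<open>The only arrow of \<open>U\<close> in the row of \<gamma> is \<open>u\<close>, so the
  sum collapses to a single term, a translation by the inverse of \<open>u\<close>.\<close>

lemma convolution_char_fun:
  fixes a :: "'r::{ring, monoid_mult}"
  assumes U: "U \<subseteq> arrows G" "inj_on (rng G) U"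
    and \<gamma>: "u \<in> U" "\<gamma> \<in> arrows G" "rng G \<gamma> = rng G u"
  shows "convolution G (\<lambda>x. a * char_fun U x) g \<gamma> = a * g (cmp G (ginv G u) \<gamma>)"
proof -
  have "row_support (\<lambda>x. a * char_fun U x) \<gamma> \<subseteq> {u}"
    using U \<gamma> by (auto simp: row_support_def char_fun_def inj_on_def split: if_splits)
  then have "convolution G (\<lambda>x. a * char_fun U x) g \<gamma> =
      (\<Sum>\<alpha>\<in>{u}. a * char_fun U \<alpha> * g (cmp G (ginv G \<alpha>) \<gamma>))"
    using U \<gamma> by (intro convolution_eq_sum) auto
  then show ?thesis
    using \<gamma> by (simp add: char_fun_def)
qed

text \<open>If some \<open>u\<close> in \<open>U\<close> has the range of \<gamma>, it is unique,
  and \<gamma> lies in the product set exactly when its translate by the inverse of \<open>u\<close>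
  lies in \<open>V\<close>. If there is none, both sides vanish.\<close>

lemma convolution_char_fun_char_fun:
  fixes a b :: "'r::{ring, monoid_mult}"
  assumes U: "U \<subseteq> arrows G" "inj_on (rng G) U" and V: "V \<subseteq> arrows G"
  shows "convolution G (\<lambda>x. a * char_fun U x) (\<lambda>x. b * char_fun V x) =
           (\<lambda>x. a * b * char_fun (arrow_product U V) x)" (is "?l = ?r")
proof
  fix \<gamma>
  have *: "\<gamma> \<in> arrow_product U V \<longleftrightarrow>
      (\<exists>u\<in>U. \<gamma> \<in> arrows G \<and> rng G \<gamma> = rng G u \<and> cmp G (ginv G u) \<gamma> \<in> V)"
  proof
    assume "\<gamma> \<in> arrow_product U V"
    then obtain u v where "(u, v) \<in> composable G" "u \<in> U" "v \<in> V" "\<gamma> = cmp G u v"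
      by (auto simp: arrow_product_def)
    then show "\<exists>u\<in>U. \<gamma> \<in> arrows G \<and> rng G \<gamma> = rng G u \<and> cmp G (ginv G u) \<gamma> \<in> V"
      by (intro bexI[of _ u]) (simp_all add: ginv_cmp_cancel cmp_closed rng_cmp)
  next
    assume "\<exists>u\<in>U. \<gamma> \<in> arrows G \<and> rng G \<gamma> = rng G u \<and> cmp G (ginv G u) \<gamma> \<in> V"
    then obtain u where u: "u \<in> U" "\<gamma> \<in> arrows G" "rng G \<gamma> = rng G u" "cmp G (ginv G u) \<gamma> \<in> V"
      by blast
    moreover have "u \<in> arrows G"
      using u U by blast
    ultimately have "(u, cmp G (ginv G u) \<gamma>) \<in> composable G" "\<gamma> = cmp G u (cmp G (ginv G u) \<gamma>)"
      by (simp_all add: groupoid_simps cmp_ginv_cancel)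
    then show "\<gamma> \<in> arrow_product U V"
      using u unfolding arrow_product_def by blast
  qed
  show "?l \<gamma> = ?r \<gamma>"
  proof (cases "\<exists>u\<in>U. \<gamma> \<in> arrows G \<and> rng G \<gamma> = rng G u")
    case True
    then obtain u where u: "u \<in> U" "\<gamma> \<in> arrows G" "rng G \<gamma> = rng G u"
      by blast
    then have "\<gamma> \<in> arrow_product U V \<longleftrightarrow> cmp G (ginv G u) \<gamma> \<in> V"
      using * U(2) by (metis inj_onD)
    then show ?thesis
      unfolding convolution_char_fun[OF U u] by (simp add: char_fun_def)
  next
    case False
    then have "row_support (\<lambda>x. a * char_fun U x) \<gamma> = {}" if "\<gamma> \<in> arrows G"
      using that by (force simp: row_support_def char_fun_def split: if_splits)
    then have "?l \<gamma> = 0"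
      using convolution_row_support[OF row_finite_char_fun[OF U], of \<gamma> a "\<lambda>x. b * char_fun V x"]
      by (cases "\<gamma> \<in> arrows G") (simp_all add: convolution_outside)
    moreover have "\<gamma> \<notin> arrow_product U V"
      using False * by blast
    ultimately show ?thesis
      by (simp add: char_fun_def)
  qed
qed

section \<open>Extension from generators to left spans\<close>

lemma row_finite_left_span:
  fixes f :: "'g \<Rightarrow> 'r::{ring, monoid_mult}"
  assumes "f \<in> left_span S" "\<And>\<phi> a. \<phi> \<in> S \<Longrightarrow> row_finite (\<lambda>x. a * \<phi> x)"
  shows "row_finite f"
  using assms(1)
proof (induction rule: left_span_induct)
  case zero
  show ?case
    by (rule row_finite_0)
next
  case (add f \<phi> a)
  show ?case
    by (rule row_finite_add[OF add(1) assms(2)[OF add(2)]])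
qed

text \<open>Induction on the right factor for a fixed scaled generator on the left, then on the left
  factor. Both coefficients appear in \<open>prod\<close> because over a noncommutative ring
  \<open>b\<close> cannot in general be moved out to the left.\<close>

lemma convolution_left_span:
  fixes f g :: "'g \<Rightarrow> 'r::{ring, monoid_mult}"
  assumes f: "f \<in> left_span S" and g: "g \<in> left_span T"
    and S: "\<And>\<phi> a. \<phi> \<in> S \<Longrightarrow> row_finite (\<lambda>x. a * \<phi> x)"
    and prod: "\<And>\<phi> \<psi> a b. \<phi> \<in> S \<Longrightarrow> \<psi> \<in> T \<Longrightarrow>
      convolution G (\<lambda>x. a * \<phi> x) (\<lambda>x. b * \<psi> x) \<in> left_span Q"
  shows "convolution G f g \<in> left_span Q"
proof -
  have *: "convolution G (\<lambda>x. a * \<phi> x) g \<in> left_span Q" if \<phi>: "\<phi> \<in> S" for \<phi> a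
    using g
  proof (induction rule: left_span_induct)
    case zero
    show ?case
      unfolding convolution_0_right by (rule left_span_0)
  next
    case (add g \<psi> b)
    show ?case
      unfolding convolution_add_right[OF S[OF \<phi>]]
      by (rule left_span_add[OF add(1) prod[OF \<phi> add(2)]])
  qed
  \<comment> \<open>Row-finiteness travels with the induction since additivity in the left factor
    requires it of the partial sums.\<close>
  have "row_finite f \<and> convolution G f g \<in> left_span Q"
    using f
  proof (induction rule: left_span_induct)
    case zero
    show ?case
      unfolding convolution_0_left using row_finite_0 left_span_0 by blast
  next
    case (add f \<phi> a)
    then show ?case
      using row_finite_add[of f] convolution_add_left[of f] left_span_add[OF _ *] S by metis
  qed
  then show ?thesis ..
qed

end

section \<open>Compact open bisections\<close>

text \<open>Restriction to an open set keeps the map open, and a continuous open bijection is a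
  homeomorphism.\<close>

lemma homeomorphic_map_injective_restriction:
  assumes "continuous_map X Y f" "open_map X Y f" "openin X U" "inj_on f U"
  shows "homeomorphic_map (subtopology X U) (subtopology Y (f ` U)) f"
proof (rule bijective_open_imp_homeomorphic_map)
  have U: "U \<subseteq> topspace X" "f ` U \<subseteq> topspace Y"
    using assms by (auto simp: openin_subset open_map_def)
  then show "f ` topspace (subtopology X U) = topspace (subtopology Y (f ` U))"
    "inj_on f (topspace (subtopology X U))"
    using assms(4) by (simp_all add: inf_absorb2)
  show "continuous_map (subtopology X U) (subtopology Y (f ` U)) f"
    using assms(1) by (auto simp: continuous_map_in_subtopology continuous_map_from_subtopology)
  show "open_map (subtopology X U) (subtopology Y (f ` U)) f"
    using assms(2,3)
    by (auto simp: open_map_def openin_open_subtopology intro!: subset_openin_subtopology)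
qed

section \<open>Continuity of the structure maps\<close>

context topological_groupoid
begin

lemma continuous_map_cmp:
  assumes "continuous_map X (gtop G) f" "continuous_map X (gtop G) g"
    and "\<And>x. x \<in> topspace X \<Longrightarrow> src G (f x) = rng G (g x)"
  shows "continuous_map X (gtop G) (\<lambda>x. cmp G (f x) (g x))"
proof -
  have "f x \<in> arrows G" "g x \<in> arrows G" if "x \<in> topspace X" for x
    using assms(1,2) that by (auto simp: arrows_def continuous_map_def)
  then have "continuous_map X (subtopology (prod_topology (gtop G) (gtop G)) (composable G))
      (\<lambda>x. (f x, g x))"
    using assms by (auto simp: continuous_map_in_subtopology continuous_map_paired composable_iff)
  from continuous_map_compose[OF this continuous_cmp] show ?thesis
    by (simp add: o_def)
qed

text \<open>The range of \<open>x\<close> is the product of \<open>x\<close> with its inverse, so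
  continuity of composition and inversion suffices.\<close>

lemma continuous_map_rng: "continuous_map (gtop G) (unit_space G) (rng G)"
proof -
  have "continuous_map (gtop G) (gtop G) (\<lambda>x. cmp G x (ginv G x))"
    by (intro continuous_map_cmp continuous_ginv continuous_map_id[unfolded id_def])
      (auto simp: groupoid_simps arrows_def[symmetric])
  then have "continuous_map (gtop G) (gtop G) (rng G)"
    by (rule continuous_map_eq) (simp add: cmp_ginv_right arrows_def)
  then show ?thesis
    using rng_in_units by (auto simp: unit_space_def continuous_map_in_subtopology arrows_def)
qed

lemma continuous_map_src: "continuous_map (gtop G) (unit_space G) (src G)"
  using continuous_map_compose[OF continuous_ginv continuous_map_rng]
  by (rule continuous_map_eq) (simp add: rng_ginv arrows_def)

lemma ginv_image_eq: "U \<subseteq> arrows G \<Longrightarrow> ginv G ` U = {x \<in> topspace (gtop G). ginv G x \<in> U}"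
  using ginv_ginv ginv_closed by (force simp: arrows_def[symmetric])

lemma openin_ginv_image: "openin (gtop G) U \<Longrightarrow> openin (gtop G) (ginv G ` U)"
  using openin_continuous_map_preimage[OF continuous_ginv] ginv_image_eq openin_subset
  by (metis arrows_def)

end

section \<open>Open structure maps and bisections\<close>

context etale_groupoid
begin

text \<open>Openness is local: around each point of \<open>W\<close> the range restricts to a
  homeomorphism onto an open set, which carries the part of \<open>W\<close> in that neighbourhood
  to an open set.\<close>

lemma open_map_rng: "open_map (gtop G) (unit_space G) (rng G)"
  unfolding open_map_def
proof (intro allI impI)
  fix W
  assume W: "openin (gtop G) W"
  have "\<exists>T. openin (unit_space G) T \<and> rng G x \<in> T \<and> T \<subseteq> rng G ` W" if "x \<in> W" for x
  proof -
    have "x \<in> topspace (gtop G)"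
      using W that openin_subset by blast
    then obtain U where U: "openin (gtop G) U" "x \<in> U" "openin (unit_space G) (rng G ` U)"
      and h: "homeomorphic_map (subtopology (gtop G) U) (subtopology (unit_space G) (rng G ` U)) (rng G)"
      using local_homeomorphism_rng unfolding local_homeomorphism_def by blast
    have "openin (subtopology (gtop G) U) (U \<inter> W)"
      using W by (simp add: openin_subtopology_Int2)
    then have "openin (subtopology (unit_space G) (rng G ` U)) (rng G ` (U \<inter> W))"
      using homeomorphic_imp_open_map[OF h] by (simp add: open_map_def)
    then have "openin (unit_space G) (rng G ` (U \<inter> W))"
      using U(3) openin_trans_full by blast
    then show ?thesis
      using U(2) that by blast
  qed
  then show "openin (unit_space G) (rng G ` W)"
    by (subst openin_subopen) blast
qed

lemma open_map_src: "open_map (gtop G) (unit_space G) (src G)"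
  unfolding open_map_def
proof (intro allI impI)
  fix W
  assume W: "openin (gtop G) W"
  then have "src G ` W = rng G ` ginv G ` W"
    using openin_subset[OF W] by (auto simp: rng_ginv arrows_def image_image intro!: image_cong)
  then show "openin (unit_space G) (src G ` W)"
    using open_map_rng openin_ginv_image[OF W] by (simp add: open_map_def)
qed

text \<open>Range and source are already continuous and open, so on an open set only injectivity
  separates them from homeomorphisms onto open images.\<close>

lemma bisection_iff:
  "bisection G U \<longleftrightarrow> openin (gtop G) U \<and> inj_on (rng G) U \<and> inj_on (src G) U"
proof
  assume U: "bisection G U"
  then have "topspace (subtopology (gtop G) U) = U"
    by (auto simp: bisection_def dest: openin_subset)
  then show "openin (gtop G) U \<and> inj_on (rng G) U \<and> inj_on (src G) U"
    using U homeomorphic_imp_injective_map unfolding bisection_def by metis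
next
  assume "openin (gtop G) U \<and> inj_on (rng G) U \<and> inj_on (src G) U"
  then show "bisection G U"
    using homeomorphic_map_injective_restriction[OF continuous_map_rng open_map_rng]
      homeomorphic_map_injective_restriction[OF continuous_map_src open_map_src]
      open_map_rng open_map_src
    by (auto simp: bisection_def open_map_def)
qed

text \<open>The range identifies a bisection with a subspace of the Hausdorff unit space.\<close>

lemma Hausdorff_bisection:
  assumes "bisection G U"
  shows "Hausdorff_space (subtopology (gtop G) U)"
  using assms homeomorphic_map_imp_homeomorphic_space homeomorphic_Hausdorff_space
    Hausdorff_space_subtopology[OF Hausdorff_unit_space]
  unfolding bisection_def by blast

lemma compact_open_bisection_iff:
  "compact_open_bisection G U \<longleftrightarrow>
     openin (gtop G) U \<and> inj_on (rng G) U \<and> inj_on (src G) U \<and> compactin (gtop G) U"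
  using Hausdorff_bisection
  by (auto simp: compact_open_bisection_def compact_Hausdorff_in_def bisection_iff)

lemma compact_open_bisection_subset: "compact_open_bisection G U \<Longrightarrow> U \<subseteq> arrows G"
  by (simp add: compact_open_bisection_iff arrows_def openin_subset)

text \<open>Openness of \<open>C\<close> keeps the intersection open and closedness keeps it
  compact. This serves to cut a bisection along a fibre of the cocycle.\<close>

lemma compact_open_bisection_Int:
  assumes "compact_open_bisection G U" "openin (gtop G) C" "closedin (gtop G) C"
  shows "compact_open_bisection G (U \<inter> C)"
  using assms unfolding compact_open_bisection_iff
  by (auto intro: inj_on_subset compact_Int_closedin)

text \<open>Inversion is continuous and its own inverse, and it interchanges range and source, hence
  the two injectivity conditions.\<close>

lemma compact_open_bisection_ginv:
  assumes "compact_open_bisection G U"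
  shows "compact_open_bisection G (ginv G ` U)"
  using assms compact_open_bisection_subset[OF assms]
  by (auto simp: compact_open_bisection_iff openin_ginv_image inj_on_def rng_ginv src_ginv subset_iff
      intro!: image_compactin[OF _ continuous_ginv])

section \<open>Products of compact open bisections\<close>

lemma closedin_composable: "closedin (prod_topology (gtop G) (gtop G)) (composable G)"
proof -
  \<comment> \<open>The composable pairs form the equalizer of two continuous maps into the unit
    space, which is closed because that space is Hausdorff.\<close>
  have "composable G =
      {p \<in> topspace (prod_topology (gtop G) (gtop G)). (src G \<circ> fst) p = (rng G \<circ> snd) p}"
    by (auto simp: composable_def arrows_def)
  then show ?thesis
    using closedin_continuous_maps_eq[OF Hausdorff_unit_space
        continuous_map_compose[OF continuous_map_fst continuous_map_src]
        continuous_map_compose[OF continuous_map_snd continuous_map_rng]]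
    by simp
qed

text \<open>The product set is the image under composition of the composable pairs in
  \<open>U \<times> V\<close>, a closed part of a compact set.\<close>

lemma compactin_arrow_product:
  assumes "compactin (gtop G) U" "compactin (gtop G) V"
  shows "compactin (gtop G) (arrow_product U V)"
proof -
  have "compactin (prod_topology (gtop G) (gtop G)) (composable G \<inter> U \<times> V)"
    using closedin_composable assms by (intro closed_Int_compactin) (simp_all add: compactin_Times)
  then have "compactin (subtopology (prod_topology (gtop G) (gtop G)) (composable G))
      (composable G \<inter> U \<times> V)"
    by (simp add: compactin_subtopology)
  from image_compactin[OF this continuous_cmp]
  show ?thesis
    by (rule back_subst[of "compactin (gtop G)"]) (force simp: arrow_product_def)
qed

text \<open>
  The product is the preimage of \<open>V\<close> under the continuous map sending \<open>\<gamma>\<close> to \<open>u\<inverse>\<gamma>\<close>, where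
  \<open>u\<close> is the unique arrow of \<open>U\<close> with the range of \<open>\<gamma>\<close>.
\<close>
lemma openin_arrow_product:
  assumes U: "bisection G U" and V: "openin (gtop G) V"
  shows "openin (gtop G) (arrow_product U V)"
proof -
  have oU: "openin (gtop G) U" and inj: "inj_on (rng G) U"
    using U by (auto simp: bisection_iff)
  have Ua: "U \<subseteq> arrows G" and Va: "V \<subseteq> arrows G"
    using oU V by (simp_all add: arrows_def openin_subset)
  have orU: "openin (unit_space G) (rng G ` U)"
    using U by (simp add: bisection_def)
  \<comment> \<open>The continuous inverse of the range on \<open>U\<close>; it selects the arrow of
    \<open>U\<close> with a given range.\<close>
  obtain \<sigma> where \<sigma>: "homeomorphic_maps (subtopology (gtop G) U)
      (subtopology (unit_space G) (rng G ` U)) (rng G) \<sigma>"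
    using U unfolding bisection_def homeomorphic_map_maps by blast
  have \<sigma>r: "\<sigma> (rng G u) = u" if "u \<in> U" for u
    using \<sigma> that Ua by (auto simp: homeomorphic_maps_def arrows_def)
  have cont\<sigma>: "continuous_map (subtopology (unit_space G) (rng G ` U)) (gtop G) \<sigma>"
    using \<sigma> by (auto simp: homeomorphic_maps_def continuous_map_in_subtopology)
  define D where "D = {\<gamma> \<in> topspace (gtop G). rng G \<gamma> \<in> rng G ` U}"
  have oD: "openin (gtop G) D"
    unfolding D_def by (rule openin_continuous_map_preimage[OF continuous_map_rng orU])
  have "continuous_map (subtopology (gtop G) D) (subtopology (unit_space G) (rng G ` U)) (rng G)"
    using continuous_map_from_subtopology[OF continuous_map_rng]
    by (auto simp: continuous_map_in_subtopology D_def)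
  then have "continuous_map (subtopology (gtop G) D) (gtop G) (ginv G \<circ> (\<sigma> \<circ> rng G))"
    by (intro continuous_map_compose[OF _ continuous_ginv] continuous_map_compose[OF _ cont\<sigma>])
  moreover have "continuous_map (subtopology (gtop G) D) (gtop G) (\<lambda>\<gamma>. \<gamma>)"
    using continuous_map_from_subtopology[OF continuous_map_id] by (simp add: id_def)
  ultimately have "continuous_map (subtopology (gtop G) D) (gtop G)
      (\<lambda>\<gamma>. cmp G ((ginv G \<circ> (\<sigma> \<circ> rng G)) \<gamma>) \<gamma>)" (is "continuous_map _ _ ?t")
  proof (rule continuous_map_cmp)
    fix \<gamma>
    assume "\<gamma> \<in> topspace (subtopology (gtop G) D)"
    then obtain u where "u \<in> U" "rng G \<gamma> = rng G u"
      by (auto simp: D_def)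
    then show "src G ((ginv G \<circ> (\<sigma> \<circ> rng G)) \<gamma>) = rng G \<gamma>"
      using \<sigma>r Ua by (auto simp: src_ginv)
  qed
  from openin_continuous_map_preimage[OF this V]
  have "openin (gtop G) {\<gamma> \<in> topspace (subtopology (gtop G) D). ?t \<gamma> \<in> V}"
    using openin_trans_full oD by blast
  also have "{\<gamma> \<in> topspace (subtopology (gtop G) D). ?t \<gamma> \<in> V} = arrow_product U V" (is "?L = _")
  proof (intro equalityI subsetI)
    fix \<gamma>
    assume "\<gamma> \<in> ?L"
    then obtain u where u: "u \<in> U" "rng G \<gamma> = rng G u" "\<gamma> \<in> arrows G" "?t \<gamma> \<in> V"
      by (auto simp: D_def arrows_def)
    then have "cmp G (ginv G u) \<gamma> \<in> V" "u \<in> arrows G"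
      using \<sigma>r Ua by auto
    then have "\<gamma> = cmp G u (cmp G (ginv G u) \<gamma>)" "(u, cmp G (ginv G u) \<gamma>) \<in> composable G"
      using u by (simp_all add: groupoid_simps cmp_ginv_cancel)
    then show "\<gamma> \<in> arrow_product U V"
      using u(1) \<open>cmp G (ginv G u) \<gamma> \<in> V\<close> unfolding arrow_product_def by blast
  next
    fix \<gamma>
    assume "\<gamma> \<in> arrow_product U V"
    then obtain u v where "(u, v) \<in> composable G" "u \<in> U" "v \<in> V" "\<gamma> = cmp G u v"
      by (auto simp: arrow_product_def)
    then show "\<gamma> \<in> ?L"
      using cmp_closed[of u v] \<sigma>r by (simp add: D_def arrows_def rng_cmp ginv_cmp_cancel)
  qed
  finally show ?thesis .
qed

text \<open>The range of a product is that of its left factor, which is thereby determined in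
  \<open>U\<close>; the source of the left factor is the range of the right one, which is then
  determined in \<open>V\<close>. Sources are treated symmetrically.\<close>

lemma compact_open_bisection_arrow_product:
  assumes U: "compact_open_bisection G U" and V: "compact_open_bisection G V"
  shows "compact_open_bisection G (arrow_product U V)"
proof -
  have "inj_on (rng G) (arrow_product U V)"
  proof (rule inj_onI)
    fix \<gamma> \<gamma>'
    assume "\<gamma> \<in> arrow_product U V" "\<gamma>' \<in> arrow_product U V" and eq: "rng G \<gamma> = rng G \<gamma>'"
    then obtain x y x' y' where
      xy: "(x, y) \<in> composable G" "x \<in> U" "y \<in> V" "\<gamma> = cmp G x y" and
      xy': "(x', y') \<in> composable G" "x' \<in> U" "y' \<in> V" "\<gamma>' = cmp G x' y'"
      by (auto simp: arrow_product_def)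
    then have "x = x'"
      using eq U by (auto simp: compact_open_bisection_iff rng_cmp inj_on_def)
    moreover from this have "y = y'"
      using xy xy' V by (auto simp: compact_open_bisection_iff inj_on_def composable_iff)
    ultimately show "\<gamma> = \<gamma>'"
      using xy xy' by simp
  qed
  moreover have "inj_on (src G) (arrow_product U V)"
  proof (rule inj_onI)
    fix \<gamma> \<gamma>'
    assume "\<gamma> \<in> arrow_product U V" "\<gamma>' \<in> arrow_product U V" and eq: "src G \<gamma> = src G \<gamma>'"
    then obtain x y x' y' where
      xy: "(x, y) \<in> composable G" "x \<in> U" "y \<in> V" "\<gamma> = cmp G x y" and
      xy': "(x', y') \<in> composable G" "x' \<in> U" "y' \<in> V" "\<gamma>' = cmp G x' y'"
      by (auto simp: arrow_product_def)
    then have "y = y'"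
      using eq V by (auto simp: compact_open_bisection_iff src_cmp inj_on_def)
    moreover from this have "x = x'"
      using xy xy' U by (auto simp: compact_open_bisection_iff inj_on_def composable_iff)
    ultimately show "\<gamma> = \<gamma>'"
      using xy xy' by simp
  qed
  ultimately show ?thesis
    using U V openin_arrow_product compactin_arrow_product
    by (auto simp: compact_open_bisection_iff bisection_iff)
qed

end

section \<open>The grading\<close>

locale graded_etale_groupoid = etale_groupoid +
  fixes c :: "'a \<Rightarrow> 'h::group_add"
  assumes continuous_cocycle: "continuous_cocycle G c"
begin

abbreviation conv :: "('a \<Rightarrow> 'r) \<Rightarrow> ('a \<Rightarrow> 'r) \<Rightarrow> 'a \<Rightarrow> 'r::{ring, monoid_mult}"
    (infixl "\<star>" 70) where
  "f \<star> g \<equiv> convolution G f g"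

abbreviation component :: "'h \<Rightarrow> ('a \<Rightarrow> 'r::{ring, monoid_mult}) set" where
  "component \<equiv> steinberg_component G c"

section \<open>Values and fibres of the cocycle\<close>

lemma cocycle_cmp: "(x, y) \<in> composable G \<Longrightarrow> c (cmp G x y) = c x + c y"
  using continuous_cocycle by (auto simp: continuous_cocycle_def cocycle_def)

text \<open>A unit is idempotent, and the only idempotent of a group is its identity.\<close>

lemma cocycle_unit:
  assumes "x \<in> units G"
  shows "c x = 0"
proof -
  have "x \<in> arrows G" "src G x = x" "rng G x = x"
    using assms by (auto simp: units_def groupoid_simps)
  then have "c x + c x = c x + 0"
    using cocycle_cmp[of x x] cmp_src[of x] by (simp add: composable_iff)
  then show ?thesis
    by (rule add_left_imp_eq)
qed

lemma cocycle_ginv: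
  assumes "x \<in> arrows G"
  shows "c (ginv G x) = - c x"
  using cocycle_cmp[of "ginv G x" x] cocycle_unit[of "src G x"] assms src_in_units
  by (simp add: composable_iff groupoid_simps cmp_ginv_left eq_neg_iff_add_eq_0)

text \<open>Singletons are clopen in the discrete group. The intersection with
  \<open>topspace (gtop G)\<close> is taken because nothing is known about \<open>c\<close> off the
  arrows.\<close>

lemma
  shows openin_fibre: "openin (gtop G) (topspace (gtop G) \<inter> c -` {h})"
    and closedin_fibre: "closedin (gtop G) (topspace (gtop G) \<inter> c -` {h})"
  using continuous_cocycle
    openin_continuous_map_preimage[of "gtop G" "discrete_topology UNIV" c "{h}"]
    closedin_continuous_map_preimage[of "gtop G" "discrete_topology UNIV" c "{h}"]
  by (simp_all add: continuous_cocycle_def vimage_def Int_def)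

section \<open>Homogeneous components\<close>

lemma row_finite_steinberg_algebra:
  assumes "f \<in> steinberg_algebra G"
  shows "row_finite f"
  using assms unfolding steinberg_algebra_def
  by (rule row_finite_left_span)
    (use compact_open_bisection_subset in
      \<open>auto simp: compact_open_bisection_iff intro!: row_finite_char_fun\<close>)

lemma component_subset: "component h \<subseteq> steinberg_algebra G"
  unfolding steinberg_component_def steinberg_algebra_def by (intro left_span_mono) blast

lemma row_finite_component: "f \<in> component h \<Longrightarrow> row_finite f"
  using row_finite_steinberg_algebra component_subset by blast

text \<open>By the cocycle identity the product of bisections of degrees \<open>g\<close> and
  \<open>h\<close> has degree \<open>g + h\<close>; the rest is extension from generators.\<close>

lemma convolution_component:
  fixes f k :: "'a \<Rightarrow> 'r::{ring, monoid_mult}"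
  assumes "f \<in> component g" "k \<in> component h"
  shows "f \<star> k \<in> component (g + h)"
  using assms unfolding steinberg_component_def
proof (rule convolution_left_span)
  fix \<phi> :: "'a \<Rightarrow> 'r" and a :: 'r
  assume "\<phi> \<in> {char_fun U |U. compact_open_bisection G U \<and> U \<subseteq> c -` {g}}"
  then obtain U where U: "\<phi> = char_fun U" "compact_open_bisection G U" "U \<subseteq> c -` {g}"
    by blast
  then have U': "U \<subseteq> arrows G" "inj_on (rng G) U"
    by (simp_all add: compact_open_bisection_subset compact_open_bisection_iff[of U])
  then show "row_finite (\<lambda>x. a * \<phi> x)"
    unfolding U by (rule row_finite_char_fun)
  fix \<psi> :: "'a \<Rightarrow> 'r" and b :: 'r
  assume "\<psi> \<in> {char_fun U |U. compact_open_bisection G U \<and> U \<subseteq> c -` {h}}"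
  then obtain V where V: "\<psi> = char_fun V" "compact_open_bisection G V" "V \<subseteq> c -` {h}"
    by blast
  have "arrow_product U V \<subseteq> c -` {g + h}"
    using U(3) V(3) by (auto simp: arrow_product_def cocycle_cmp subset_iff)
  then show "(\<lambda>x. a * \<phi> x) \<star> (\<lambda>x. b * \<psi> x)
      \<in> left_span {char_fun U |U. compact_open_bisection G U \<and> U \<subseteq> c -` {g + h}}"
    unfolding U(1) V(1) convolution_char_fun_char_fun[OF U' compact_open_bisection_subset[OF V(2)]]
    using compact_open_bisection_arrow_product[OF U(2) V(2)] by (intro left_span_scale) blast
qed

lemma component_add: "f \<in> component h \<Longrightarrow> g \<in> component h \<Longrightarrow> f + g \<in> component h"
  unfolding steinberg_component_def by (rule left_span_add)

lemma component_diff: "f \<in> component h \<Longrightarrow> g \<in> component h \<Longrightarrow> f - g \<in> component h"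
  unfolding steinberg_component_def by (rule left_span_diff)

text \<open>Each generator contributes its bisection to a cover of the support. Cancellation may
  make the cover larger than the support.\<close>

lemma component_support:
  assumes "f \<in> component h"
  shows "\<exists>\<U>. finite \<U> \<and> (\<forall>U\<in>\<U>. compact_open_bisection G U \<and> U \<subseteq> c -` {h}) \<and>
           (\<forall>x. f x \<noteq> 0 \<longrightarrow> x \<in> \<Union>\<U>)"
  using assms unfolding steinberg_component_def
proof (induction rule: left_span_induct)
  case zero
  show ?case
    by (intro exI[of _ "{}"]) simp
next
  case (add f \<phi> a)
  from add.IH obtain \<U> where \<U>: "finite \<U>" "\<forall>U\<in>\<U>. compact_open_bisection G U \<and> U \<subseteq> c -` {h}"
    "\<forall>x. f x \<noteq> 0 \<longrightarrow> x \<in> \<Union>\<U>"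
    by (elim exE conjE)
  obtain U where "\<phi> = char_fun U" "compact_open_bisection G U" "U \<subseteq> c -` {h}"
    using add.hyps by blast
  moreover have "x \<in> \<Union>(insert U \<U>)" if "(f + (\<lambda>x. a * \<phi> x)) x \<noteq> 0" for x
    using that \<U>(3) by (cases "x \<in> U") (auto simp: \<open>\<phi> = char_fun U\<close> char_fun_def)
  ultimately show ?case
    using \<U>(1,2) by (intro exI[of _ "insert U \<U>"]) simp
qed

lemma component_vanishes:
  assumes "f \<in> component h" "c x \<noteq> h"
  shows "f x = 0"
  using component_support[OF assms(1)] assms(2) by blast

section \<open>From regularity in degree zero to graded regularity\<close>

text \<open>
  The set \<open>B\<close> consists of the indicators of \<open>U\<inverse>\<close> for bisections \<open>U\<close> covering the support of \<open>x\<close>.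
\<close>
lemma component_test:
  fixes x :: "'a \<Rightarrow> 'r::{ring, monoid_mult}"
  assumes x: "x \<in> component h"
  obtains B :: "('a \<Rightarrow> 'r) set" where "finite B" "B \<subseteq> component (- h)"
    "\<And>y. (\<And>b. b \<in> B \<Longrightarrow> b \<star> (x \<star> y - x) = 0) \<Longrightarrow> x \<star> y = x"
proof -
  obtain \<U> where \<U>: "finite \<U>" "\<forall>U\<in>\<U>. compact_open_bisection G U \<and> U \<subseteq> c -` {h}"
    "\<forall>\<gamma>. x \<gamma> \<noteq> 0 \<longrightarrow> \<gamma> \<in> \<Union>\<U>"
    using component_support[OF x] by (elim exE conjE)
  \<comment> \<open>The factor 1 gives the indicator the shape of a scaled generator, as the lemmas
    on spans and convolutions expect.\<close>
  define \<phi> :: "'a set \<Rightarrow> 'a \<Rightarrow> 'r" where "\<phi> U = (\<lambda>\<gamma>. 1 * char_fun (ginv G ` U) \<gamma>)" for U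
  show ?thesis
  proof (rule that[of "\<phi> ` \<U>"])
    show "finite (\<phi> ` \<U>)"
      using \<U>(1) by simp
    show "\<phi> ` \<U> \<subseteq> component (- h)"
    proof clarify
      fix U
      assume "U \<in> \<U>"
      then have U: "compact_open_bisection G U" "U \<subseteq> c -` {h}"
        using \<U>(2) by auto
      then have "ginv G ` U \<subseteq> c -` {- h}"
        using compact_open_bisection_subset by (auto simp: cocycle_ginv subset_iff)
      then show "\<phi> U \<in> component (- h)"
        unfolding \<phi>_def steinberg_component_def
        using compact_open_bisection_ginv[OF U(1)] by (intro left_span_scale) blast
    qed
    fix y
    assume y: "\<And>b. b \<in> \<phi> ` \<U> \<Longrightarrow> b \<star> (x \<star> y - x) = 0"
    have "(x \<star> y - x) \<eta> = 0" for \<eta>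
    proof (rule ccontr)
      assume nz: "(x \<star> y - x) \<eta> \<noteq> 0"
      then have \<eta>: "\<eta> \<in> arrows G"
        using row_finite_outside[OF row_finite_component[OF x]]
        by (cases "\<eta> \<in> arrows G") (simp_all add: convolution_outside)
      \<comment> \<open>If \<open>x\<close> vanished on the whole row of \<eta>, so would
        \<open>x \<star> y\<close> at \<eta>. Hence some bisection of the cover contains an arrow
        \<open>u\<close> with the range of \<eta>.\<close>
      have "row_support x \<eta> \<noteq> {}"
      proof
        assume "row_support x \<eta> = {}"
        then have "(x \<star> y) \<eta> = 0" "x \<eta> = 0"
          using \<eta> convolution_row_support[OF row_finite_component[OF x] \<eta>]
          by (auto simp: row_support_def)
        with nz show False
          by simp
      qed
      then obtain u U where U: "U \<in> \<U>" and u: "u \<in> U" "u \<in> arrows G" "rng G u = rng G \<eta>"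
        using \<U>(3) by (auto simp: row_support_def)
      define V where "V = ginv G ` U"
      have "compact_open_bisection G V"
        using U \<U>(2) compact_open_bisection_ginv by (auto simp: V_def)
      then have V: "V \<subseteq> arrows G" "inj_on (rng G) V"
        by (simp_all add: compact_open_bisection_subset compact_open_bisection_iff[of V])
      \<comment> \<open>Evaluating at the translate of \<eta> by the inverse of \<open>u\<close>
        undoes the translation and recovers the nonzero value at \<eta>, although this product is 0
        by assumption.\<close>
      have "(\<phi> U \<star> (x \<star> y - x)) (cmp G (ginv G u) \<eta>) =
          1 * (x \<star> y - x) (cmp G (ginv G (ginv G u)) (cmp G (ginv G u) \<eta>))"
        unfolding \<phi>_def V_def[symmetric]
        using u \<eta> by (intro convolution_char_fun[OF V]) (auto simp: V_def groupoid_simps)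
      also have "\<dots> = (x \<star> y - x) \<eta>"
        using u \<eta> by (simp add: ginv_ginv cmp_ginv_cancel)
      finally show False
        using nz y U by (simp add: zero_fun_def)
    qed
    then have "x \<star> y - x = 0"
      by (auto simp: fun_eq_iff)
    then show "x \<star> y = x"
      by simp
  qed
qed

text \<open>
  A finitely generated left ideal of a regular ring has a right unit: here the ideal generated by
  the elements \<open>b \<star> x\<close>, with right unit \<open>w \<star> x\<close>.
\<close>
lemma regular_right_unit:
  fixes x :: "'a \<Rightarrow> 'r::{ring, monoid_mult}"
  assumes reg: "von_neumann_regular (component 0 :: ('a \<Rightarrow> 'r) set) (\<star>)"
    and x: "x \<in> component h"
    and "finite B" "B \<subseteq> component (- h)"
  shows "\<exists>w\<in>component (- h). \<forall>b\<in>B. b \<star> (x \<star> (w \<star> x)) = b \<star> x"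
  using assms(3,4)
proof (induction B rule: finite_induct)
  case empty
  have "0 \<in> component (- h)"
    unfolding steinberg_component_def by (rule left_span_0)
  then show ?case
    by blast
next
  case (insert b B)
  then obtain w where w: "w \<in> component (- h)" and IH: "\<And>b. b \<in> B \<Longrightarrow> b \<star> (x \<star> (w \<star> x)) = b \<star> x"
    and b: "b \<in> component (- h)" and B: "B \<subseteq> component (- h)"
    by auto
  have wx: "w \<star> x \<in> component 0" and bx: "b \<star> x \<in> component 0"
    using convolution_component[OF w x] convolution_component[OF b x] by simp_all
  \<comment> \<open>Formally \<open>b' = b (1 - x w)\<close>, written without a unit, so
    \<open>b' x = b x (1 - w x)\<close>: this measures how far \<open>w x\<close> is from being a
    right unit for \<open>b x\<close>.\<close>
  define b' where "b' = b - (b \<star> x) \<star> w"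
  have b': "b' \<in> component (- h)"
    unfolding b'_def using convolution_component[OF bx w] b by (simp add: component_diff)
  have "b' \<star> x \<in> component 0"
    using convolution_component[OF b' x] by simp
  then obtain z where z: "z \<in> component 0" and zz: "((b' \<star> x) \<star> z) \<star> (b' \<star> x) = b' \<star> x"
    using reg unfolding von_neumann_regular_def by blast
  have zb': "z \<star> b' \<in> component (- h)"
    using convolution_component[OF z b'] by simp
  \<comment> \<open>Chosen so that formally \<open>1 - w' x = (1 - w x) (1 - z b' x)\<close>. The
    first factor is annihilated on the left by every \<open>b1 x\<close> with \<open>b1\<close> in
    \<open>B\<close>; for the new element, \<open>b x (1 - w x) = b' x\<close> is annihilated by the
    second factor. Using \<open>z \<star> b'\<close> instead of
    \<open>z \<star> (b' \<star> x)\<close> keeps \<open>w'\<close> in degree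
    \<open>- h\<close>.\<close>
  define w' where "w' = w + z \<star> b' - (w \<star> x) \<star> (z \<star> b')"
  have w': "w' \<in> component (- h)"
    unfolding w'_def
    using convolution_component[OF wx zb'] w zb' by (simp add: component_diff component_add)
  note rf = row_finite_component[OF x] row_finite_component[OF w] row_finite_component[OF b]
    row_finite_component[OF b'] row_finite_component[OF z]
    row_finite_convolution row_finite_add row_finite_diff
  have w'x: "w' \<star> x = w \<star> x + z \<star> (b' \<star> x) - w \<star> (x \<star> (z \<star> (b' \<star> x)))"
    unfolding w'_def by (simp add: rf convolution_assoc convolution_add_left convolution_diff_left)
  have "b1 \<star> (x \<star> (w' \<star> x)) = b1 \<star> x" if "b1 \<in> insert b B" for b1
  proof (cases "b1 = b")
    case True
    have b'_conv: "b' \<star> q = b \<star> q - b \<star> (x \<star> (w \<star> q))" for q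
      unfolding b'_def by (simp add: rf convolution_assoc convolution_diff_left)
    have "b' \<star> (x \<star> (z \<star> (b' \<star> x))) = b' \<star> x"
      using zz by (simp add: rf convolution_assoc)
    then have "b \<star> (x \<star> (z \<star> (b' \<star> x))) - b \<star> (x \<star> (w \<star> (x \<star> (z \<star> (b' \<star> x))))) =
        b \<star> x - b \<star> (x \<star> (w \<star> x))"
      using b'_conv[of "x \<star> (z \<star> (b' \<star> x))"] b'_conv[of x] by metis
    then show ?thesis
      unfolding True w'x by (simp add: rf convolution_add_right convolution_diff_right algebra_simps)
  next
    case False
    then have b1: "b1 \<in> B" "row_finite b1"
      using that B row_finite_component by auto
    \<comment> \<open>The induction hypothesis multiplied on the right by \<open>q\<close>; it makes
      the two terms containing \<open>z\<close> cancel.\<close>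
    have "b1 \<star> (x \<star> (w \<star> (x \<star> q))) = b1 \<star> (x \<star> q)" for q
      using arg_cong[OF IH[OF b1(1)], of "\<lambda>f. f \<star> q"] by (simp add: rf b1 convolution_assoc)
    then show ?thesis
      unfolding w'x using b1 IH
      by (simp add: rf convolution_add_right convolution_diff_right)
  qed
  then show ?case
    using w' by blast
qed

text \<open>The right unit \<open>w \<star> x\<close> passes every test in \<open>B\<close>, so
  \<open>w\<close> is a quasi-inverse of \<open>x\<close>.\<close>

lemma graded_regular_if_regular:
  assumes "von_neumann_regular (component 0 :: ('a \<Rightarrow> 'r::{ring, monoid_mult}) set) (\<star>)"
  shows "graded_regular (steinberg_algebra G :: ('a \<Rightarrow> 'r) set) (\<star>) component"
  unfolding graded_regular_def
proof (intro allI ballI)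
  fix h and x :: "'a \<Rightarrow> 'r"
  assume x: "x \<in> component h"
  obtain B :: "('a \<Rightarrow> 'r) set" where B: "finite B" "B \<subseteq> component (- h)"
    and test: "\<And>y. (\<And>b. b \<in> B \<Longrightarrow> b \<star> (x \<star> y - x) = 0) \<Longrightarrow> x \<star> y = x"
    using component_test[OF x] by blast
  obtain w where w: "w \<in> component (- h)" "\<forall>b\<in>B. b \<star> (x \<star> (w \<star> x)) = b \<star> x"
    using regular_right_unit[OF assms x B] by blast
  have "x \<star> (w \<star> x) = x"
  proof (rule test)
    fix b
    assume "b \<in> B"
    then have "row_finite b"
      using B(2) row_finite_component by blast
    then show "b \<star> (x \<star> (w \<star> x) - x) = 0"
      using w(2) \<open>b \<in> B\<close> by (simp add: convolution_diff_right)
  qed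
  then have "(x \<star> w) \<star> x = x"
    using convolution_assoc[OF row_finite_component[OF x] row_finite_component[OF w(1)], of x] by simp
  then show "\<exists>y\<in>steinberg_algebra G. (x \<star> y) \<star> x = x"
    using w(1) component_subset by blast
qed

section \<open>Projection onto degree zero and the converse implication\<close>

definition degree_zero_part :: "('a \<Rightarrow> 'r::zero) \<Rightarrow> 'a \<Rightarrow> 'r" where
  "degree_zero_part f = (\<lambda>x. if c x = 0 then f x else 0)"

text \<open>Restricting the indicator of \<open>U\<close> to the kernel gives the indicator of the
  clopen piece \<open>W\<close> of \<open>U\<close>, again a compact open bisection.\<close>

lemma degree_zero_part_component:
  fixes f :: "'a \<Rightarrow> 'r::{ring, monoid_mult}"
  assumes "f \<in> steinberg_algebra G"
  shows "degree_zero_part f \<in> component 0"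
  using assms unfolding steinberg_algebra_def
proof (induction rule: left_span_induct)
  case zero
  have "degree_zero_part 0 = (0 :: 'a \<Rightarrow> 'r)"
    by (auto simp: degree_zero_part_def)
  show ?case
    unfolding \<open>degree_zero_part 0 = 0\<close> steinberg_component_def by (rule left_span_0)
next
  case (add f \<phi> a)
  then obtain U where U: "\<phi> = char_fun U" "compact_open_bisection G U"
    by blast
  define W where "W = U \<inter> (topspace (gtop G) \<inter> c -` {0})"
  have W: "compact_open_bisection G W" "W \<subseteq> c -` {0}"
    unfolding W_def
    using compact_open_bisection_Int[OF U(2) openin_fibre closedin_fibre] by auto
  have "degree_zero_part (f + (\<lambda>x. a * \<phi> x)) = degree_zero_part f + (\<lambda>x. a * char_fun W x)"
    using compact_open_bisection_subset[OF U(2)]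
    by (auto simp: degree_zero_part_def fun_eq_iff U(1) char_fun_def W_def arrows_def)
  moreover have "(\<lambda>x. a * char_fun W x) \<in> component 0"
    unfolding steinberg_component_def using W by (intro left_span_scale) blast
  ultimately show ?case
    using component_add[OF add.IH] by metis
qed

text \<open>Arrows where \<open>f\<close> is nonzero have degree zero, so multiplying by them on the
  left preserves degrees and the projection can be moved to \<open>g\<close>.\<close>

lemma degree_zero_part_convolution_right:
  assumes "f \<in> component 0"
  shows "degree_zero_part (f \<star> g) = f \<star> degree_zero_part g"
proof
  fix \<gamma>
  have "(\<alpha>, \<beta>) \<in> composable G \<Longrightarrow> f \<alpha> \<noteq> 0 \<Longrightarrow> c (cmp G \<alpha> \<beta>) = c \<beta>" for \<alpha> \<beta>
    using cocycle_cmp[of \<alpha> \<beta>] component_vanishes[OF assms, of \<alpha>] by (cases "c \<alpha> = 0") auto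
  then show "degree_zero_part (f \<star> g) \<gamma> = (f \<star> degree_zero_part g) \<gamma>"
    unfolding convolution_def degree_zero_part_def
    by (cases "c \<gamma> = 0") (auto intro!: sum.cong sum.neutral split: if_splits)
qed

lemma degree_zero_part_convolution_left:
  assumes "f \<in> component 0"
  shows "degree_zero_part (g \<star> f) = degree_zero_part g \<star> f"
proof
  fix \<gamma>
  have "(\<alpha>, \<beta>) \<in> composable G \<Longrightarrow> f \<beta> \<noteq> 0 \<Longrightarrow> c (cmp G \<alpha> \<beta>) = c \<alpha>" for \<alpha> \<beta>
    using cocycle_cmp[of \<alpha> \<beta>] component_vanishes[OF assms, of \<beta>] by (cases "c \<beta> = 0") auto
  then show "degree_zero_part (g \<star> f) \<gamma> = (degree_zero_part g \<star> f) \<gamma>"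
    unfolding convolution_def degree_zero_part_def
    by (cases "c \<gamma> = 0") (auto intro!: sum.cong sum.neutral split: if_splits)
qed

text \<open>Projecting \<open>(a \<star> b) \<star> a = a\<close> to degree zero fixes
  \<open>a\<close> and replaces \<open>b\<close> by its degree zero part.\<close>

lemma regular_if_graded_regular:
  assumes "graded_regular (steinberg_algebra G :: ('a \<Rightarrow> 'r::{ring, monoid_mult}) set) (\<star>) component"
  shows "von_neumann_regular (component 0 :: ('a \<Rightarrow> 'r) set) (\<star>)"
  unfolding von_neumann_regular_def
proof
  fix a :: "'a \<Rightarrow> 'r"
  assume a: "a \<in> component 0"
  then obtain b where b: "b \<in> steinberg_algebra G" "(a \<star> b) \<star> a = a"
    using assms unfolding graded_regular_def by blast
  have "(a \<star> degree_zero_part b) \<star> a = degree_zero_part ((a \<star> b) \<star> a)"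
    by (simp add: a degree_zero_part_convolution_left degree_zero_part_convolution_right)
  also have "\<dots> = a"
    using component_vanishes[OF a] b(2) by (auto simp: degree_zero_part_def)
  finally show "\<exists>b\<in>component 0. (a \<star> b) \<star> a = a"
    using degree_zero_part_component[OF b(1)] by blast
qed

section \<open>The kernel groupoid\<close>

lemma arrows_kernel: "arrows (kernel_groupoid G c) = arrows G \<inter> c -` {0}"
  by (simp add: arrows_def kernel_groupoid_def)

text \<open>Units have degree zero, so the kernel contains all of them.\<close>

lemma unit_space_kernel: "unit_space (kernel_groupoid G c) = unit_space G"
proof -
  have sub: "units G \<subseteq> arrows G \<inter> c -` {0}"
    using cocycle_unit src_closed by (auto simp: units_def)
  have "src G x \<in> src G ` (arrows G \<inter> c -` {0})" if "x \<in> arrows G" for x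
    using sub src_in_units[OF that] by (subst src_src[OF that, symmetric]) blast
  then have "units (kernel_groupoid G c) = units G"
    by (auto simp: units_def arrows_kernel) (auto simp: kernel_groupoid_def)
  then show ?thesis
    using sub by (simp add: unit_space_def kernel_groupoid_def subtopology_subtopology inf_absorb2)
qed

text \<open>The kernel is open, so its open sets are the open sets of \<open>G\<close> inside it.
  Compactness and the Hausdorff property depend only on the subspace topology of \<open>U\<close>,
  and the unit spaces agree.\<close>

lemma compact_open_bisection_kernel:
  "compact_open_bisection (kernel_groupoid G c) U \<longleftrightarrow>
     compact_open_bisection G U \<and> U \<subseteq> c -` {0}"
proof (cases "U \<subseteq> c -` {0}")
  case True
  have gtop: "gtop (kernel_groupoid G c) = subtopology (gtop G) (c -` {0})"
    and maps: "src (kernel_groupoid G c) = src G" "rng (kernel_groupoid G c) = rng G"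
    by (simp_all add: kernel_groupoid_def)
  have "openin (gtop (kernel_groupoid G c)) U \<longleftrightarrow> openin (gtop G) U"
  proof
    assume "openin (gtop (kernel_groupoid G c)) U"
    then obtain T where T: "openin (gtop G) T" "U = T \<inter> c -` {0}"
      by (auto simp: gtop openin_subtopology)
    \<comment> \<open>The preimage of 0 may contain points that are not arrows; passing to the fibre
      inside the carrier makes it an open set.\<close>
    then have "U = T \<inter> (topspace (gtop G) \<inter> c -` {0})"
      using openin_subset by blast
    then show "openin (gtop G) U"
      using T(1) openin_fibre by blast
  qed (use True in \<open>auto simp: gtop openin_subtopology\<close>)
  moreover have "subtopology (gtop (kernel_groupoid G c)) U = subtopology (gtop G) U"
    using True by (simp add: gtop subtopology_subtopology inf_absorb2)
  moreover have "compactin (gtop (kernel_groupoid G c)) U \<longleftrightarrow> compactin (gtop G) U"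
    using True by (simp add: gtop compactin_subtopology)
  ultimately show ?thesis
    using True
    by (simp add: compact_open_bisection_def bisection_def compact_Hausdorff_in_def
        unit_space_kernel maps)
next
  case False
  then have "\<not> openin (gtop (kernel_groupoid G c)) U"
    by (auto simp: kernel_groupoid_def openin_subtopology)
  then show ?thesis
    using False by (auto simp: compact_open_bisection_def bisection_def)
qed

lemma steinberg_algebra_kernel: "steinberg_algebra (kernel_groupoid G c) = component 0"
  by (simp add: steinberg_algebra_def steinberg_component_def compact_open_bisection_kernel)

text \<open>Both functions vanish off the kernel, so restricting to pairs of arrows in the kernel
  removes no term.\<close>

lemma convolution_kernel:
  assumes "f \<in> component 0" "g \<in> component 0"
  shows "convolution (kernel_groupoid G c) f g = f \<star> g"
proof -
  have "f \<alpha> \<noteq> 0 \<Longrightarrow> c \<alpha> = 0" "g \<alpha> \<noteq> 0 \<Longrightarrow> c \<alpha> = 0" for \<alpha>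
    using component_vanishes assms by blast+
  then show ?thesis
    unfolding convolution_def composable_def arrows_kernel
    by (intro ext sum.cong) (auto simp: kernel_groupoid_def)
qed

text \<open>Closure of the degree zero component under convolution allows the outer product to be
  rewritten as well as the inner one.\<close>

lemma von_neumann_regular_kernel:
  "von_neumann_regular (steinberg_algebra (kernel_groupoid G c) :: ('a \<Rightarrow> 'r::{ring, monoid_mult}) set)
     (convolution (kernel_groupoid G c)) \<longleftrightarrow>
   von_neumann_regular (component 0 :: ('a \<Rightarrow> 'r) set) (\<star>)"
proof -
  have "a \<star> b \<in> component 0" if "a \<in> component 0" "b \<in> component 0" for a b :: "'a \<Rightarrow> 'r"
    using convolution_component[OF that] by simp
  then show ?thesis
    by (simp add: von_neumann_regular_def steinberg_algebra_kernel convolution_kernel)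
qed

end

theorem theorem4p2:
  fixes G :: "'g topgroupoid"
    and c :: "'g \<Rightarrow> 'h::group_add"
  assumes "ample_groupoid G"
    and "continuous_cocycle G c"
  shows "graded_regular
           (steinberg_algebra G :: ('g \<Rightarrow> 'r::{ring, monoid_mult}) set)
           (convolution G)
           (steinberg_component G c)
         \<longleftrightarrow>
         von_neumann_regular
           (steinberg_algebra (kernel_groupoid G c) :: ('g \<Rightarrow> 'r) set)
           (convolution (kernel_groupoid G c))"
proof -
  interpret ample_groupoid G
    by (rule assms(1))
  interpret graded_etale_groupoid G c
    by unfold_locales (rule assms(2))
  show ?thesis
    unfolding von_neumann_regular_kernel
    using graded_regular_if_regular regular_if_graded_regular by blast
qed

end
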